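(* Let $n$ be a positive integer and run the following algorithm (Algorithm B) on input $n$: <br/> $k\leftarrow 1$; $x\leftarrow 1$; $y\leftarrow n-1$;<br/> while $k>0$ do:<br/> while $3x\le y$ do: $a_k\leftarrow x$; $y\leftarrow y-x$; $k\leftarrow k+1$; end while;<br/> $t\leftarrow k+1$; $u\leftarrow k+2$;<br/> while $2x\le y$ do:<br/> $a_k\leftarrow x$; $a_t\leftarrow x$; $a_u\leftarrow y-x$; visit $a_1,\ldots,a_u$; $p\leftarrow x+1$; $q\leftarrow y-p$;<br/> while $p\le q$ do: $a_t\leftarrow p$; $a_u\leftarrow q$; visit $a_1,\ldots,a_u$; $p\leftarrow p+1$; $q\leftarrow q-1$; end while;<br/> $a_t\leftarrow y$; visit $a_1,\ldots,a_t$; $x\leftarrow x+1$; $y\leftarrow y-1$;<br/> end while;<br/> while $x\le y$ do: $a_k\leftarrow x$; $a_t\leftarrow y$; visit $a_1,\ldots,a_t$; $x\leftarrow x+1$; $y\leftarrow y-1$; end while;<br/> $y\leftarrow x+y-1$; $a_k\leftarrow y+1$; visit $a_1,\ldots,a_k$; $k\leftarrow k-1$; $x\leftarrow a_k+1$;<br/> end while. <br/> Then Algorithm B terminates after executing exactly $4p(n)+5p^{(3)}(n)$ assignment statements and evaluating exactly $p(n)+4p^{(3)}(n)$ boolean expressions.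
   Context: All variables are integers; $a_0,a_1,a_2,\ldots$ is an array of integer cells (with $a_0$ present, holding an arbitrary value). An "assignment statement" is one execution of a statement of the form $v\leftarrow e$; a "boolean expression evaluation" is one evaluation of the condition of a while loop (each test, including the final failing test, counts once). "visit" statements are not counted. $p(n)$ is the number of partitions of $n$ (unordered representations as sums of positive integers). $p^{(3)}(n)$ is the number of partitions $\lambda=[\lambda_1\ge\lambda_2\ge\cdots]$ of $n$ with $\lambda_1\ge 3\lambda_2$, where the one-part partition $[n]$ is considered to satisfy this condition. *)

theory Defs
  imports Main
begin

section \<open>A while language with statement counts\<close>

datatype var = Vn | Vk | Vx | Vy | Vt | Vu | Vp | Vq

text \<open>A state consists of the integer variables and the array cells \<open>a 0, a 1, a 2, \<dots>\<close>.\<close>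
type_synonym state = "(var \<Rightarrow> int) \<times> (nat \<Rightarrow> int)"

text \<open>\<open>Cell v\<close> is the array cell whose index is the value of the variable \<open>v\<close>.\<close>
datatype aexp = Num int | Var var | Cell var
  | Plus aexp aexp | Minus aexp aexp | Times aexp aexp

datatype bexp = LessEq aexp aexp | Less aexp aexp

datatype com =
    Assign var aexp        ("_ ::= _" [1000, 61] 61)
  | AssignCell var aexp    ("cell _ ::= _" [1000, 61] 61)
  | Visit var
  | Seq com com            (infixr ";;" 60)
  | While bexp com         ("(WHILE _/ DO _)" [0, 61] 61)

fun aval :: "aexp \<Rightarrow> state \<Rightarrow> int" where
  "aval (Num i) s = i"
| "aval (Var v) s = fst s v"
| "aval (Cell v) s = snd s (nat (fst s v))"
| "aval (Plus e f) s = aval e s + aval f s"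
| "aval (Minus e f) s = aval e s - aval f s"
| "aval (Times e f) s = aval e s * aval f s"

text \<open>There are no cells with a negative index: \<open>adef e s\<close> says that the evaluation of \<open>e\<close>
  reads none. A program that accesses such a cell has no execution, so the use of
  \<^const>\<open>nat\<close> in the semantics never redirects an access to the cell \<open>a 0\<close>.\<close>
fun adef :: "aexp \<Rightarrow> state \<Rightarrow> bool" where
  "adef (Num i) s = True"
| "adef (Var v) s = True"
| "adef (Cell v) s = (0 \<le> fst s v)"
| "adef (Plus e f) s = (adef e s \<and> adef f s)"
| "adef (Minus e f) s = (adef e s \<and> adef f s)"
| "adef (Times e f) s = (adef e s \<and> adef f s)"

fun bval :: "bexp \<Rightarrow> state \<Rightarrow> bool" where
  "bval (LessEq e f) s = (aval e s \<le> aval f s)"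
| "bval (Less e f) s = (aval e s < aval f s)"

fun bdef :: "bexp \<Rightarrow> state \<Rightarrow> bool" where
  "bdef (LessEq e f) s = (adef e s \<and> adef f s)"
| "bdef (Less e f) s = (adef e s \<and> adef f s)"

text \<open>\<open>exec c s i j s'\<close>: started in state \<open>s\<close>, the program \<open>c\<close> terminates in state \<open>s'\<close> after
  executing exactly \<open>i\<close> assignment statements and evaluating exactly \<open>j\<close> loop conditions.
  Visits read the array only; they leave the state unchanged and are not counted.\<close>
inductive exec :: "com \<Rightarrow> state \<Rightarrow> nat \<Rightarrow> nat \<Rightarrow> state \<Rightarrow> bool" where
  Assign: "adef e s \<Longrightarrow> exec (v ::= e) s 1 0 ((fst s)(v := aval e s), snd s)"
| AssignCell: "0 \<le> fst s v \<Longrightarrow> adef e s \<Longrightarrow>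
    exec (cell v ::= e) s 1 0 (fst s, (snd s)(nat (fst s v) := aval e s))"
| Visit: "exec (Visit v) s 0 0 s"
| Seq: "exec c s i j s' \<Longrightarrow> exec d s' i' j' s'' \<Longrightarrow> exec (c ;; d) s (i + i') (j + j') s''"
| WhileFalse: "bdef b s \<Longrightarrow> \<not> bval b s \<Longrightarrow> exec (WHILE b DO c) s 0 1 s"
| WhileTrue: "bdef b s \<Longrightarrow> bval b s \<Longrightarrow> exec c s i j s' \<Longrightarrow>
    exec (WHILE b DO c) s' i' j' s'' \<Longrightarrow> exec (WHILE b DO c) s (i + i') (1 + j + j') s''"

inductive_cases AssignE: "exec (v ::= e) s i j s'"
  and AssignCellE: "exec (cell v ::= e) s i j s'"
  and VisitE: "exec (Visit v) s i j s'"
  and SeqE: "exec (c ;; d) s i j s'"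
  and WhileE: "exec (WHILE b DO c) s i j s'"

text \<open>Executions are deterministic, so the counts are determined by program and initial state.\<close>
lemma exec_deterministic:
  "exec c s i j s' \<Longrightarrow> exec c s i' j' s'' \<Longrightarrow> i' = i \<and> j' = j \<and> s'' = s'"
proof (induction arbitrary: i' j' s'' rule: exec.induct)
  case Assign
  then show ?case by (auto elim: AssignE)
next
  case AssignCell
  then show ?case by (auto elim: AssignCellE)
next
  case Visit
  then show ?case by (auto elim: VisitE)
next
  case Seq
  then show ?case by (elim SeqE) blast
next
  case WhileFalse
  then show ?case by (auto elim: WhileE)
next
  case (WhileTrue b s c i1 j1 s1 i2 j2 s2)
  from WhileTrue.prems WhileTrue.hyps obtain i3 j3 s3 i4 j4 where
    "exec c s i3 j3 s3" "exec (WHILE b DO c) s3 i4 j4 s''" "i' = i3 + i4" "j' = 1 + j3 + j4"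
    by (auto elim: WhileE)
  then show ?case using WhileTrue.IH by blast
qed


section \<open>The algorithm\<close>

text \<open>The input is the initial value of the variable \<open>Vn\<close>; \<open>Visit v\<close> visits
  \<open>a 1, \<dots>, a v\<close>.\<close>
definition algorithm_B :: com where
  "algorithm_B =
    Vk ::= Num 1 ;;
    Vx ::= Num 1 ;;
    Vy ::= Minus (Var Vn) (Num 1) ;;
    WHILE Less (Num 0) (Var Vk) DO (
      WHILE LessEq (Times (Num 3) (Var Vx)) (Var Vy) DO (
        cell Vk ::= Var Vx ;;
        Vy ::= Minus (Var Vy) (Var Vx) ;;
        Vk ::= Plus (Var Vk) (Num 1)) ;;
      Vt ::= Plus (Var Vk) (Num 1) ;;
      Vu ::= Plus (Var Vk) (Num 2) ;;
      WHILE LessEq (Times (Num 2) (Var Vx)) (Var Vy) DO (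
        cell Vk ::= Var Vx ;;
        cell Vt ::= Var Vx ;;
        cell Vu ::= Minus (Var Vy) (Var Vx) ;;
        Visit Vu ;;
        Vp ::= Plus (Var Vx) (Num 1) ;;
        Vq ::= Minus (Var Vy) (Var Vp) ;;
        WHILE LessEq (Var Vp) (Var Vq) DO (
          cell Vt ::= Var Vp ;;
          cell Vu ::= Var Vq ;;
          Visit Vu ;;
          Vp ::= Plus (Var Vp) (Num 1) ;;
          Vq ::= Minus (Var Vq) (Num 1)) ;;
        cell Vt ::= Var Vy ;;
        Visit Vt ;;
        Vx ::= Plus (Var Vx) (Num 1) ;;
        Vy ::= Minus (Var Vy) (Num 1)) ;;
      WHILE LessEq (Var Vx) (Var Vy) DO (
        cell Vk ::= Var Vx ;;
        cell Vt ::= Var Vy ;;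
        Visit Vt ;;
        Vx ::= Plus (Var Vx) (Num 1) ;;
        Vy ::= Minus (Var Vy) (Num 1)) ;;
      Vy ::= Minus (Plus (Var Vx) (Var Vy)) (Num 1) ;;
      cell Vk ::= Plus (Var Vy) (Num 1) ;;
      Visit Vk ;;
      Vk ::= Minus (Var Vk) (Num 1) ;;
      Vx ::= Plus (Cell Vk) (Num 1))"


section \<open>Partitions\<close>

definition partitions :: "nat \<Rightarrow> nat list set" where
  "partitions n = {l. sorted_wrt (\<ge>) l \<and> (\<forall>m \<in> set l. 0 < m) \<and> sum_list l = n}"

definition p :: "nat \<Rightarrow> nat" where
  "p n = card (partitions n)"

text \<open>Parts are indexed from 0 here: \<open>l ! 0\<close> is the largest part, \<open>l ! 1\<close> the second one.\<close>
definition p3 :: "nat \<Rightarrow> nat" where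
  "p3 n = card {l \<in> partitions n. length l = 1 \<or> (2 \<le> length l \<and> l ! 0 \<ge> 3 * l ! 1)}"

lemma finite_partitions: "finite (partitions n)"
proof (rule finite_subset)
  show "partitions n \<subseteq> {l. set l \<subseteq> {..n} \<and> length l \<le> n}"
  proof
    fix l assume "l \<in> partitions n"
    then have pos: "\<forall>m \<in> set l. 0 < m" and n: "sum_list l = n"
      by (auto simp: partitions_def)
    have "(\<forall>m \<in> set l. 0 < m) \<Longrightarrow> length l \<le> sum_list l" by (induction l) auto
    with pos n member_le_sum_list[of _ l] show "l \<in> {l. set l \<subseteq> {..n} \<and> length l \<le> n}"
      by auto
  qed
  show "finite {l. set l \<subseteq> {..n} \<and> length l \<le> n}"
    by (rule finite_lists_length_le) simp
qed

end

theory Submission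
  imports Defs
begin

text \<open>Let \<open>C x m\<close> count the partitions of \<open>m\<close> with all parts at least \<open>x\<close>, and let \<open>L x m\<close>
  count those among them that have a single part or satisfy \<open>\<lambda>\<^sub>1 \<ge> 3 \<lambda>\<^sub>2\<close>. When the outer loop is
  entered at level \<open>k\<close> with \<open>x + y = m\<close>, the algorithm runs through the former partitions and then
  returns to level \<open>k - 1\<close>. If \<open>3 * x \<le> y\<close>, it pushes \<open>x\<close>, treats \<open>(x, m - x)\<close> at the next level
  and then \<open>(x + 1, m)\<close> at the present one; the push costs 3 assignments and 1 test. Otherwise
  \<open>m < 4 * x\<close>, there is no recursion, and the loops cost 4 assignments and 1 test per visit, plus 2
  and 3. Both \<open>C\<close> and \<open>L\<close> satisfy \<open>F x m = F x (m - x) + F (x + 1) m\<close> for \<open>4 * x \<le> m\<close>, and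
  \<open>L x m = 1\<close> for \<open>x \<le> m < 4 * x\<close>. Hence the costs are \<open>4 * C + 5 * L - 3\<close> and \<open>C + 4 * L - 1\<close>.\<close>

section \<open>Partitions with a lower bound on the parts\<close>

definition parts_ge :: "nat \<Rightarrow> nat \<Rightarrow> nat list set" where
  "parts_ge x m = {l \<in> partitions m. \<forall>e \<in> set l. x \<le> e}"

text \<open>The empty list is excluded, so it adds 1 to \<open>num_ge x 0\<close> and 0 to
  \<open>num_dominant_ge x 0\<close>.\<close>

definition dominant :: "nat list \<Rightarrow> bool" where
  "dominant l \<longleftrightarrow> length l = 1 \<or> (2 \<le> length l \<and> l ! 0 \<ge> 3 * l ! 1)"

definition num_ge :: "nat \<Rightarrow> nat \<Rightarrow> nat" where
  "num_ge x m = card (parts_ge x m)"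

definition num_dominant_ge :: "nat \<Rightarrow> nat \<Rightarrow> nat" where
  "num_dominant_ge x m = card {l \<in> parts_ge x m. dominant l}"

lemma finite_parts_ge: "finite (parts_ge x m)"
  by (simp add: parts_ge_def finite_partitions)

lemma parts_ge_1: "parts_ge 1 m = partitions m"
  by (auto simp: parts_ge_def partitions_def Suc_le_eq)

lemma p_eq_num_ge: "p m = num_ge 1 m"
  by (simp only: p_def num_ge_def parts_ge_1)

lemma p3_eq_num_dominant_ge: "p3 m = num_dominant_ge 1 m"
  by (simp only: p3_def num_dominant_ge_def parts_ge_1 dominant_def)

text \<open>The smallest part is the last list element: either it is \<open>x\<close> and can be
  removed, or all parts exceed \<open>x\<close>.\<close>

lemma parts_ge_split:
  assumes "1 \<le> x" "x \<le> m"
  shows "parts_ge x m = (\<lambda>l. l @ [x]) ` parts_ge x (m - x) \<union> parts_ge (x + 1) m"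
proof (intro equalityI subsetI)
  fix l assume l: "l \<in> parts_ge x m"
  show "l \<in> (\<lambda>l. l @ [x]) ` parts_ge x (m - x) \<union> parts_ge (x + 1) m"
  proof (cases l rule: rev_cases)
    case Nil
    with l assms show ?thesis by (auto simp: parts_ge_def partitions_def)
  next
    case (snoc l' z)
    show ?thesis
    proof (cases "z = x")
      case True
      with l snoc have "l' \<in> parts_ge x (m - x)"
        by (auto simp: parts_ge_def partitions_def sorted_wrt_append)
      with snoc True show ?thesis by blast
    next
      case False
      with l snoc have "l \<in> parts_ge (x + 1) m"
        by (fastforce simp: parts_ge_def partitions_def sorted_wrt_append)
      then show ?thesis by blast
    qed
  qed
next
  fix l assume "l \<in> (\<lambda>l. l @ [x]) ` parts_ge x (m - x) \<union> parts_ge (x + 1) m"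
  then show "l \<in> parts_ge x m"
    using assms by (auto simp: parts_ge_def partitions_def sorted_wrt_append)
qed

lemma parts_ge_split_disjoint:
  "(\<lambda>l. l @ [x]) ` A \<inter> parts_ge (x + 1) m = {}"
  by (auto simp: parts_ge_def)

section \<open>Recurrences and base cases for the two counts\<close>

lemma num_ge_rec:
  assumes "1 \<le> x" "x \<le> m"
  shows "num_ge x m = num_ge x (m - x) + num_ge (x + 1) m"
proof -
  have "card ((\<lambda>l. l @ [x]) ` parts_ge x (m - x)) = num_ge x (m - x)"
    unfolding num_ge_def by (rule card_image) (simp add: inj_on_def)
  with parts_ge_split[OF assms] parts_ge_split_disjoint show ?thesis
    by (simp only: num_ge_def card_Un_disjoint finite_parts_ge finite_imageI)
qed

lemma num_ge_0: "num_ge x 0 = 1"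
proof -
  have "parts_ge x 0 = {[]}"
    by (auto simp: parts_ge_def partitions_def) (metis gr_implies_not0 list.set_intros(1) neq_Nil_conv)
  then show ?thesis by (simp add: num_ge_def)
qed

lemma num_ge_eq_0:
  assumes "1 \<le> m" "m < x"
  shows "num_ge x m = 0"
proof -
  have "l \<notin> parts_ge x m" for l
    using assms by (cases l) (auto simp: parts_ge_def partitions_def)
  then have "parts_ge x m = {}" by blast
  then show ?thesis by (simp add: num_ge_def)
qed

text \<open>Two parts would sum to at least \<open>2 * x\<close>, so only \<open>[m]\<close>
  remains.\<close>

lemma num_ge_eq_1:
  assumes "1 \<le> x" "x \<le> m" "m < 2 * x"
  shows "num_ge x m = 1"
  using assms
proof (induction "m - x" arbitrary: x)
  case 0
  then show ?case using num_ge_rec[of x m] by (simp add: num_ge_0 num_ge_eq_0)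
next
  case (Suc d)
  have "num_ge (x + 1) m = 1" using Suc by (intro Suc.hyps(1)) auto
  moreover have "num_ge x (m - x) = 0" using Suc by (intro num_ge_eq_0) auto
  ultimately show ?case using num_ge_rec[of x m] Suc by simp
qed

text \<open>The only partition lost is \<open>[m - x, x]\<close>, as the remainder
  \<open>m - x\<close> is below \<open>2 * x\<close>. One round of a loop over two-part partitions
  corresponds to this step.\<close>

lemma num_ge_step:
  assumes "1 \<le> x" "2 * x \<le> m" "m < 3 * x"
  shows "num_ge x m = Suc (num_ge (Suc x) m)"
  using num_ge_rec[of x m] num_ge_eq_1[of x "m - x"] assms by simp

text \<open>The new last part is among the first two only if \<open>l = [m - x]\<close>; then the
  condition is \<open>m - x \<ge> 3 * x\<close>, which is the test for a push.\<close>

lemma dominant_snoc: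
  assumes "l \<in> parts_ge x (m - x)" "1 \<le> x" "4 * x \<le> m"
  shows "dominant (l @ [x]) \<longleftrightarrow> dominant l"
proof (cases l)
  case Nil
  with assms show ?thesis by (auto simp: parts_ge_def partitions_def)
next
  case (Cons z l')
  with assms show ?thesis
    by (cases l') (auto simp: parts_ge_def partitions_def dominant_def)
qed

lemma num_dominant_ge_rec:
  assumes "1 \<le> x" "4 * x \<le> m"
  shows "num_dominant_ge x m = num_dominant_ge x (m - x) + num_dominant_ge (x + 1) m"
proof -
  have "x \<le> m" using assms by simp
  let ?A = "(\<lambda>l. l @ [x]) ` {l \<in> parts_ge x (m - x). dominant l}"
  let ?B = "{l \<in> parts_ge (x + 1) m. dominant l}"
  have "{l \<in> parts_ge x m. dominant l} = ?A \<union> ?B"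
    unfolding parts_ge_split[OF \<open>1 \<le> x\<close> \<open>x \<le> m\<close>] using dominant_snoc[OF _ assms] by blast
  moreover have "?A \<inter> ?B = {}" using parts_ge_split_disjoint by blast
  moreover have "card ?A = num_dominant_ge x (m - x)"
    unfolding num_dominant_ge_def by (rule card_image) (simp add: inj_on_def)
  ultimately show ?thesis
    by (simp add: num_dominant_ge_def card_Un_disjoint finite_parts_ge)
qed

text \<open>A second part \<open>b \<ge> x\<close> would force a sum of at least
  \<open>3 * b + b \<ge> 4 * x\<close>.\<close>

lemma num_dominant_ge_eq_1:
  assumes "1 \<le> x" "x \<le> m" "m < 4 * x"
  shows "num_dominant_ge x m = 1"
proof -
  have "{l \<in> parts_ge x m. dominant l} = {[m]}"
  proof (intro equalityI subsetI)
    fix l assume l: "l \<in> {l \<in> parts_ge x m. dominant l}"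
    show "l \<in> {[m]}"
    proof (cases "length l = 1")
      case True
      with l show ?thesis by (auto simp: length_Suc_conv parts_ge_def partitions_def)
    next
      case False
      with l obtain a b r where "l = a # b # r" "a \<ge> 3 * b"
        by (cases l; cases "tl l") (auto simp: dominant_def)
      with l assms show ?thesis by (auto simp: parts_ge_def partitions_def)
    qed
  next
    fix l assume "l \<in> {[m]}"
    with assms show "l \<in> {l \<in> parts_ge x m. dominant l}"
      by (auto simp: parts_ge_def partitions_def dominant_def)
  qed
  then show ?thesis by (simp add: num_dominant_ge_def)
qed

lemma num_dominant_ge_pos:
  assumes "1 \<le> x" "x \<le> m"
  shows "1 \<le> num_dominant_ge x m"
proof -
  have "[m] \<in> {l \<in> parts_ge x m. dominant l}"
    using assms by (auto simp: parts_ge_def partitions_def dominant_def)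
  then show ?thesis
    by (auto simp: num_dominant_ge_def Suc_le_eq card_gt_0_iff finite_parts_ge)
qed

section \<open>A weakest precondition calculus with counts\<close>

text \<open>Total correctness: termination is part of the claim. The counts are arguments of the
  postcondition, so that sequencing merely shifts them.\<close>

definition run :: "com \<Rightarrow> (nat \<Rightarrow> nat \<Rightarrow> state \<Rightarrow> bool) \<Rightarrow> state \<Rightarrow> bool" where
  "run c Q s \<longleftrightarrow> (\<exists>i j s'. exec c s i j s' \<and> Q i j s')"

lemma run_mono:
  "run c Q s \<Longrightarrow> (\<And>i j s'. Q i j s' \<Longrightarrow> Q' i j s') \<Longrightarrow> run c Q' s"
  unfolding run_def by blast

lemma run_Assign [simp]:
  "run (v ::= e) Q s \<longleftrightarrow> adef e s \<and> Q 1 0 ((fst s)(v := aval e s), snd s)"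
    (is "?L \<longleftrightarrow> ?R")
proof
  assume ?L
  then show ?R by (auto simp: run_def elim!: AssignE)
next
  assume R: ?R
  then have "exec (v ::= e) s 1 0 ((fst s)(v := aval e s), snd s)" by (blast intro: exec.Assign)
  with R show ?L unfolding run_def by blast
qed

lemma run_AssignCell [simp]:
  "run (cell v ::= e) Q s \<longleftrightarrow>
    0 \<le> fst s v \<and> adef e s \<and> Q 1 0 (fst s, (snd s)(nat (fst s v) := aval e s))"
    (is "?L \<longleftrightarrow> ?R")
proof
  assume ?L
  then show ?R by (auto simp: run_def elim!: AssignCellE)
next
  assume R: ?R
  then have "exec (cell v ::= e) s 1 0 (fst s, (snd s)(nat (fst s v) := aval e s))"
    by (blast intro: exec.AssignCell)
  with R show ?L unfolding run_def by blast
qed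

lemma run_Visit [simp]: "run (Visit v) Q s \<longleftrightarrow> Q 0 0 s"
  unfolding run_def by (blast elim: VisitE intro: exec.Visit)

lemma run_Seq [simp]:
  "run (c ;; d) Q s \<longleftrightarrow> run c (\<lambda>i j. run d (\<lambda>i' j'. Q (i + i') (j + j'))) s"
  unfolding run_def by (blast elim: SeqE intro: exec.Seq)

lemma run_While:
  "run (WHILE b DO c) Q s \<longleftrightarrow> bdef b s \<and>
    (if bval b s then run c (\<lambda>i j. run (WHILE b DO c) (\<lambda>i' j'. Q (i + i') (1 + j + j'))) s
     else Q 0 1 s)"
    (is "?L \<longleftrightarrow> ?R")
proof
  assume ?L
  then obtain i j s' where "exec (WHILE b DO c) s i j s'" and Q: "Q i j s'"
    unfolding run_def by blast
  from this(1) show ?R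
  proof cases
    case WhileFalse
    with Q show ?thesis by simp
  next
    case (WhileTrue i1 j1 s1 i2 j2)
    with Q show ?thesis unfolding run_def by (simp only: if_True simp_thms) blast
  qed
next
  assume R: ?R
  show ?L
  proof (cases "bval b s")
    case True
    with R obtain i1 j1 s1 i2 j2 s' where "bdef b s" "exec c s i1 j1 s1"
      "exec (WHILE b DO c) s1 i2 j2 s'" "Q (i1 + i2) (1 + j1 + j2) s'"
      unfolding run_def by (simp only: if_True simp_thms) blast
    with True exec.WhileTrue show ?thesis unfolding run_def by blast
  next
    case False
    with R exec.WhileFalse show ?thesis unfolding run_def by (simp only: if_False) blast
  qed
qed

text \<open>A push is followed by another test of the inner condition, not of the outer one. It can still
  be treated as a fresh entry into the outer loop, because the outer test at \<open>s1\<close> replaces the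
  one at \<open>s\<close>; only the inner test at \<open>s\<close> is added.\<close>
lemma exec_While_While:
  assumes "exec c s i j s1" "bdef b s" "bval b s" "bdef b' s" "bval b' s" "bval b s1"
    and "exec (WHILE b DO (WHILE b' DO c ;; d)) s1 i' j' s'"
  shows "exec (WHILE b DO (WHILE b' DO c ;; d)) s (i + i') (1 + j + j') s'"
proof -
  from assms(6,7) obtain i1 j1 s2 i2 j2 where body: "exec (WHILE b' DO c ;; d) s1 i1 j1 s2"
    and W: "exec (WHILE b DO (WHILE b' DO c ;; d)) s2 i2 j2 s'"
    and ij: "i' = i1 + i2" "j' = 1 + j1 + j2"
    by (auto elim: WhileE)
  from body obtain i3 j3 s3 i4 j4 where "exec (WHILE b' DO c) s1 i3 j3 s3" "exec d s3 i4 j4 s2"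
    and ij1: "i1 = i3 + i4" "j1 = j3 + j4"
    by (auto elim: SeqE)
  then have "exec (WHILE b' DO c ;; d) s ((i + i3) + i4) ((1 + j + j3) + j4) s2"
    using assms by (blast intro: exec.Seq exec.WhileTrue)
  from exec.WhileTrue[OF assms(2,3) this W] show ?thesis
    by (simp add: ij ij1 ac_simps)
qed

section \<open>The loops of the algorithm\<close>

definition push_body :: com where
  "push_body =
    cell Vk ::= Var Vx ;;
    Vy ::= Minus (Var Vy) (Var Vx) ;;
    Vk ::= Plus (Var Vk) (Num 1)"

definition pair_loop :: com where
  "pair_loop =
    WHILE LessEq (Var Vp) (Var Vq) DO (
      cell Vt ::= Var Vp ;;
      cell Vu ::= Var Vq ;;
      Visit Vu ;;
      Vp ::= Plus (Var Vp) (Num 1) ;;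
      Vq ::= Minus (Var Vq) (Num 1))"

definition triple_loop :: com where
  "triple_loop =
    WHILE LessEq (Times (Num 2) (Var Vx)) (Var Vy) DO (
      cell Vk ::= Var Vx ;;
      cell Vt ::= Var Vx ;;
      cell Vu ::= Minus (Var Vy) (Var Vx) ;;
      Visit Vu ;;
      Vp ::= Plus (Var Vx) (Num 1) ;;
      Vq ::= Minus (Var Vy) (Var Vp) ;;
      pair_loop ;;
      cell Vt ::= Var Vy ;;
      Visit Vt ;;
      Vx ::= Plus (Var Vx) (Num 1) ;;
      Vy ::= Minus (Var Vy) (Num 1))"

definition double_loop :: com where
  "double_loop =
    WHILE LessEq (Var Vx) (Var Vy) DO (
      cell Vk ::= Var Vx ;;
      cell Vt ::= Var Vy ;;
      Visit Vt ;;
      Vx ::= Plus (Var Vx) (Num 1) ;;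
      Vy ::= Minus (Var Vy) (Num 1))"

definition leaf :: com where
  "leaf =
    Vt ::= Plus (Var Vk) (Num 1) ;;
    Vu ::= Plus (Var Vk) (Num 2) ;;
    triple_loop ;;
    double_loop ;;
    Vy ::= Minus (Plus (Var Vx) (Var Vy)) (Num 1) ;;
    cell Vk ::= Plus (Var Vy) (Num 1) ;;
    Visit Vk ;;
    Vk ::= Minus (Var Vk) (Num 1) ;;
    Vx ::= Plus (Cell Vk) (Num 1)"

definition outer_loop :: com where
  "outer_loop =
    WHILE Less (Num 0) (Var Vk) DO (
      WHILE LessEq (Times (Num 3) (Var Vx)) (Var Vy) DO push_body ;; leaf)"

lemma algorithm_B_outer_loop:
  "algorithm_B =
    Vk ::= Num 1 ;; Vx ::= Num 1 ;; Vy ::= Minus (Var Vn) (Num 1) ;; outer_loop"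
  by (simp add: algorithm_B_def outer_loop_def push_body_def leaf_def triple_loop_def
      pair_loop_def double_loop_def)

section \<open>Invariants and costs of the inner loops\<close>

definition level :: "nat \<Rightarrow> nat \<Rightarrow> nat \<Rightarrow> state \<Rightarrow> bool" where
  "level k x m s \<longleftrightarrow> fst s Vk = int k \<and> fst s Vx = int x \<and> fst s Vy = int m - int x"

definition pointers :: "nat \<Rightarrow> state \<Rightarrow> bool" where
  "pointers k s \<longleftrightarrow> fst s Vt = int k + 1 \<and> fst s Vu = int k + 2"

text \<open>The cells below \<open>k\<close> form the stack of pushed parts; the inner loops write
  only to the cells \<open>k\<close>, \<open>k + 1\<close> and \<open>k + 2\<close>.\<close>

definition agree :: "nat \<Rightarrow> state \<Rightarrow> state \<Rightarrow> bool" where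
  "agree k s s' \<longleftrightarrow> (\<forall>i<k. snd s' i = snd s i)"

text \<open>As \<open>y < 3 * r\<close>, there are at most two parts. Each round visits one pair;
  \<open>[y]\<close> is left out, which saves 4 assignments, while the failing test restores the
  count of tests.\<close>

lemma run_pair_loop:
  assumes "level k x m s" "pointers k s" "1 \<le> r" "r \<le> y" "y < 3 * r"
    and "fst s Vp = int r" "fst s Vq = int y - int r"
  shows "run pair_loop (\<lambda>i j s'. i + 4 = 4 * num_ge r y \<and> j = num_ge r y \<and>
    level k x m s' \<and> pointers k s' \<and> agree k s s') s"
  using assms
proof (induction "y - r" arbitrary: r s rule: less_induct)
  case less
  show ?case
  proof (cases "2 * r \<le> y")
    case True
    let ?s = "((fst s)(Vp := int r + 1, Vq := int y - int r - 1),
      (snd s)(k + 1 := int r, k + 2 := int y - int r))"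
    have "run pair_loop (\<lambda>i j s'. i + 4 = 4 * num_ge (Suc r) y \<and> j = num_ge (Suc r) y \<and>
        level k x m s' \<and> pointers k s' \<and> agree k ?s s') ?s"
      using less.prems True by (intro less.hyps) (auto simp: level_def pointers_def)
    moreover have "agree k ?s s' \<longleftrightarrow> agree k s s'" for s'
      by (auto simp: agree_def)
    ultimately show ?thesis
      using less.prems True num_ge_step[of r y] unfolding pair_loop_def
      by (subst run_While)
        (auto simp: pointers_def nat_add_distrib add.commute elim!: run_mono)
  next
    case False
    then show ?thesis
      using less.prems num_ge_eq_1[of r y] unfolding pair_loop_def
      by (subst run_While) (auto simp: agree_def)
  qed
qed

text \<open>A round at \<open>x\<close> handles exactly the partitions of \<open>m\<close> with
  smallest part \<open>x\<close>, at 4 assignments and 1 test each; the extra test is the failing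
  one. Sums instead of differences avoid truncated subtraction.\<close>

lemma run_triple_loop:
  assumes "level k x m s" "pointers k s" "1 \<le> x" "x \<le> m" "m < 4 * x"
  shows "run triple_loop (\<lambda>i j s'. \<exists>x'. 1 \<le> x' \<and> x' \<le> m \<and> m < 3 * x' \<and>
    i + 4 * num_ge x' m = 4 * num_ge x m \<and> j + num_ge x' m = num_ge x m + 1 \<and>
    level k x' m s' \<and> pointers k s' \<and> agree k s s') s"
  using assms
proof (induction "m - x" arbitrary: x s rule: less_induct)
  case less
  show ?case
  proof (cases "3 * x \<le> m")
    case True
    let ?s = "((fst s)(Vp := 1 + int x, Vq := int m - 1 - 2 * int x),
      (snd s)(k := int x, Suc k := int x, Suc (Suc k) := int m - 2 * int x))"
    have s: "fst s Vk = int k" "fst s Vx = int x" "fst s Vy = int m - int x"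
      "fst s Vt = int k + 1" "fst s Vu = int k + 2"
      using less.prems by (simp_all add: level_def pointers_def)
    \<comment> \<open>Together these count the visits of one round; the \<open>Suc\<close> in the
      second equation stands for the partition of \<open>m - x\<close> into \<open>x\<close> and
      \<open>m - 2 * x\<close>.\<close>
    have rec: "num_ge x m = num_ge x (m - x) + num_ge (Suc x) m"
      "num_ge x (m - x) = Suc (num_ge (Suc x) (m - x))"
      using num_ge_rec[of x m] num_ge_step[of x "m - x"] less.prems True by simp_all
    have pair: "run pair_loop (\<lambda>i j s'. i + 4 = 4 * num_ge (Suc x) (m - x) \<and>
        j = num_ge (Suc x) (m - x) \<and> level k x m s' \<and> pointers k s' \<and> agree k ?s s') ?s"
      using less.prems True
      by (intro run_pair_loop) (auto simp: level_def pointers_def of_nat_diff)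
    have next_it: "run triple_loop (\<lambda>i j s'. \<exists>x'. 1 \<le> x' \<and> x' \<le> m \<and> m < 3 * x' \<and>
        i + 4 * num_ge x' m = 4 * num_ge (Suc x) m \<and>
        j + num_ge x' m = num_ge (Suc x) m + 1 \<and>
        level k x' m s' \<and> pointers k s' \<and> agree k s s') s2"
      if s2: "level k (Suc x) m s2" "pointers k s2" "agree k s s2" for s2
    proof -
      have "agree k s2 s' \<longleftrightarrow> agree k s s'" for s'
        using s2(3) by (auto simp: agree_def)
      then show ?thesis
        using less.hyps[OF _ s2(1,2)] less.prems True by auto
    qed
    \<comment> \<open>The five \<open>Suc\<close> are the assignments before
      \<open>pair_loop\<close>; \<open>1 + j\<close> includes the test that opened the
      round.\<close>
    have rest: "run (cell Vt ::= Var Vy ;; Visit Vt ;; Vx ::= Plus (Var Vx) (Num 1) ;;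
          Vy ::= Minus (Var Vy) (Num 1) ;; triple_loop)
        (\<lambda>i' j' s''. \<exists>x'. 1 \<le> x' \<and> x' \<le> m \<and> m < 3 * x' \<and>
          Suc (Suc (Suc (Suc (Suc (i + i'))))) + 4 * num_ge x' m = 4 * num_ge x m \<and>
          1 + j + j' + num_ge x' m = num_ge x m + 1 \<and>
          level k x' m s'' \<and> pointers k s'' \<and> agree k s s'') s'"
      if "i + 4 = 4 * num_ge (Suc x) (m - x)" "j = num_ge (Suc x) (m - x)"
        "level k x m s'" "pointers k s'" "agree k ?s s'" for i j s'
    proof -
      let ?s' = "((fst s')(Vx := int x + 1, Vy := int m - int x - 1),
        (snd s')(Suc k := int m - int x))"
      have "level k (Suc x) m ?s'" "pointers k ?s'" "agree k s ?s'"
        using that by (auto simp: level_def pointers_def agree_def)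
      from next_it[OF this] that rec show ?thesis
        by (auto simp: level_def pointers_def nat_add_distrib elim!: run_mono ex_forward)
    qed
    show ?thesis
      unfolding triple_loop_def
      by (subst run_While, unfold triple_loop_def[symmetric])
        (use less.prems(3-5) True s rest in
          \<open>auto simp: nat_add_distrib add.commute intro!: run_mono[OF pair]\<close>)
  next
    case False
    then show ?thesis
      using less.prems unfolding triple_loop_def
      by (subst run_While) (auto simp: agree_def level_def)
  qed
qed

lemma run_double_loop:
  assumes "level k x m s" "pointers k s" "1 \<le> x" "x \<le> m" "m < 3 * x"
  shows "run double_loop (\<lambda>i j s'. \<exists>x'. i + 4 = 4 * num_ge x m \<and> j = num_ge x m \<and>
    level k x' m s' \<and> agree k s s') s"
  using assms
proof (induction "m - x" arbitrary: x s rule: less_induct)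
  case less
  show ?case
  proof (cases "2 * x \<le> m")
    case True
    let ?s = "((fst s)(Vx := int x + 1, Vy := int m - int x - 1),
      (snd s)(k := int x, k + 1 := int m - int x))"
    have "run double_loop (\<lambda>i j s'. \<exists>x'. i + 4 = 4 * num_ge (Suc x) m \<and>
        j = num_ge (Suc x) m \<and> level k x' m s' \<and> agree k ?s s') ?s"
      using less.prems True by (intro less.hyps) (auto simp: level_def pointers_def)
    moreover have "agree k ?s s' \<longleftrightarrow> agree k s s'" for s'
      by (auto simp: agree_def)
    ultimately show ?thesis
      using less.prems True num_ge_step[of x m] unfolding double_loop_def
      by (subst run_While)
        (auto simp: level_def pointers_def nat_add_distrib add.commute elim!: run_mono)
  next
    case False
    then show ?thesis
      using less.prems num_ge_eq_1[of x m] unfolding double_loop_def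
      by (subst run_While) (auto simp: agree_def level_def)
  qed
qed

text \<open>If the child was entered with remainder \<open>m\<close>, its parent had remainder
  \<open>m\<close> plus the pushed part. Hence the new values of \<open>Vx\<close> and
  \<open>Vy\<close> again sum to the parent's remainder. For \<open>k = 1\<close> the cell read is
  \<open>a 0\<close>.\<close>

definition popped :: "nat \<Rightarrow> nat \<Rightarrow> state \<Rightarrow> state \<Rightarrow> bool" where
  "popped k m s s' \<longleftrightarrow> fst s' Vk = int k - 1 \<and> fst s' Vy = int m - 1 \<and>
    fst s' Vx = snd s (k - 1) + 1 \<and> agree k s s'"

text \<open>The loops cover all partitions except \<open>[m]\<close>, hence 4 assignments fewer;
  setting the pointers adds 2, and the final visit and pop add 4. The extra test is due to two loops
  failing once each.\<close>

lemma run_leaf: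
  assumes "level k x m s" "1 \<le> k" "1 \<le> x" "x \<le> m" "m < 4 * x"
  shows "run leaf (\<lambda>i j s'. i = 4 * num_ge x m + 2 \<and> j = num_ge x m + 1 \<and> popped k m s s') s"
proof -
  let ?s = "((fst s)(Vt := int k + 1, Vu := int k + 2), snd s)"
  let ?Q = "\<lambda>i j s'. i + 4 = 4 * num_ge x m \<and> j = num_ge x m + 1 \<and>
    (\<exists>x'. level k x' m s' \<and> agree k s s')"
  have "run (triple_loop ;; double_loop) ?Q ?s"
    unfolding run_Seq
  proof (rule run_mono[OF run_triple_loop])
    show "level k x m ?s" "pointers k ?s"
      using assms by (auto simp: level_def pointers_def)
  next
    fix i j s'
    assume "\<exists>x'. 1 \<le> x' \<and> x' \<le> m \<and> m < 3 * x' \<and>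
      i + 4 * num_ge x' m = 4 * num_ge x m \<and> j + num_ge x' m = num_ge x m + 1 \<and>
      level k x' m s' \<and> pointers k s' \<and> agree k ?s s'"
    then obtain x' where "1 \<le> x'" "x' \<le> m" "m < 3 * x'" "level k x' m s'" "pointers k s'"
      and *: "agree k ?s s'" "i + 4 * num_ge x' m = 4 * num_ge x m"
        "j + num_ge x' m = num_ge x m + 1"
      by blast
    then have "run double_loop (\<lambda>i j s''. \<exists>x''. i + 4 = 4 * num_ge x' m \<and> j = num_ge x' m \<and>
        level k x'' m s'' \<and> agree k s' s'') s'"
      by (intro run_double_loop)
    then show "run double_loop (\<lambda>i' j'. ?Q (i + i') (j + j')) s'"
      by (rule run_mono) (use * in \<open>auto simp: agree_def\<close>)
  qed (use assms in auto)
  moreover have "nat (int k - 1) = k - 1" using assms(2) by auto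
  ultimately show ?thesis
    using assms(1,2) unfolding leaf_def
    by (auto simp: level_def popped_def agree_def elim!: run_mono)
qed

section \<open>The recursion hidden in the outer loop\<close>

lemma run_push:
  assumes "level k x m s" "1 \<le> k" "4 * x \<le> m"
    and "run outer_loop (\<lambda>i j. Q (3 + i) (1 + j))
      ((fst s)(Vy := int m - int x - int x, Vk := int k + 1), (snd s)(k := int x))"
      (is "run _ _ ?s")
  shows "run outer_loop Q s"
proof -
  have "run push_body (\<lambda>i j s'. i = 3 \<and> j = 0 \<and> s' = ?s) s"
    using assms(1) by (simp add: push_body_def level_def)
  then have push: "exec push_body s 3 0 ?s"
    by (auto simp: run_def)
  from assms(4) obtain i j s' where "exec outer_loop ?s i j s'" "Q (3 + i) (1 + j) s'"
    by (auto simp: run_def)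
  moreover from this(1) have "exec outer_loop s (3 + i) (1 + 0 + j) s'"
    unfolding outer_loop_def
    by (rule exec_While_While[OF push, rotated -1]) (use assms in \<open>auto simp: level_def\<close>)
  ultimately show ?thesis unfolding run_def by (metis add_0_right)
qed

text \<open>Handling a subtree ends in the middle of the run of \<open>outer_loop\<close>, so the
  claim is in continuation style: \<open>Q\<close> is general, and the last assumption covers the
  run after the pop.\<close>

lemma run_outer_loop:
  assumes "level k x m s" "1 \<le> k" "1 \<le> x" "x \<le> m"
    and "i + 3 = 4 * num_ge x m + 5 * num_dominant_ge x m"
    and "j + 1 = num_ge x m + 4 * num_dominant_ge x m"
    and "\<And>s1. popped k m s s1 \<Longrightarrow> run outer_loop (\<lambda>i' j'. Q (i + i') (j + j')) s1"
  shows "run outer_loop Q s"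
  using assms
proof (induction "m - x" arbitrary: k x m s i j Q rule: less_induct)
  case less
  show ?case
  proof (cases "4 * x \<le> m")
    case True
    let ?s = "((fst s)(Vy := int m - int x - int x, Vk := int k + 1), (snd s)(k := int x))"
    define i1 where "i1 = 4 * num_ge x (m - x) + 5 * num_dominant_ge x (m - x) - 3"
    define j1 where "j1 = num_ge x (m - x) + 4 * num_dominant_ge x (m - x) - 1"
    define i2 where "i2 = 4 * num_ge (Suc x) m + 5 * num_dominant_ge (Suc x) m - 3"
    define j2 where "j2 = num_ge (Suc x) m + 4 * num_dominant_ge (Suc x) m - 1"
    \<comment> \<open>This makes the truncated subtractions of 3 and 1 exact.\<close>
    have pos: "1 \<le> num_dominant_ge x (m - x)" "1 \<le> num_dominant_ge (Suc x) m"
      using less.prems True by (auto intro!: num_dominant_ge_pos[unfolded One_nat_def])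
    have i: "i = 3 + (i1 + i2)" and j: "j = 1 + (j1 + j2)"
      using less.prems(3-6) True num_ge_rec[of x m] num_dominant_ge_rec[of x m] pos
      unfolding i1_def i2_def j1_def j2_def by simp_all linarith+
    have "run outer_loop (\<lambda>i j. Q (3 + i) (1 + j)) ?s"
    proof (rule less.hyps)
      show "i1 + 3 = 4 * num_ge x (m - x) + 5 * num_dominant_ge x (m - x)"
        "j1 + 1 = num_ge x (m - x) + 4 * num_dominant_ge x (m - x)"
        using pos by (simp_all add: i1_def j1_def)
      show "level (Suc k) x (m - x) ?s"
        using less.prems True by (auto simp: level_def of_nat_diff)
    next
      fix s1 assume s1: "popped (Suc k) (m - x) ?s s1"
      show "run outer_loop (\<lambda>i' j'. Q (3 + (i1 + i')) (1 + (j1 + j'))) s1"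
      proof (rule less.hyps)
        show "i2 + 3 = 4 * num_ge (Suc x) m + 5 * num_dominant_ge (Suc x) m"
          "j2 + 1 = num_ge (Suc x) m + 4 * num_dominant_ge (Suc x) m"
          using pos by (simp_all add: i2_def j2_def)
        \<comment> \<open>The pop reads back the \<open>x\<close> pushed into cell \<open>k\<close>,
          and \<open>Vy\<close> is \<open>(m - x) - 1 = m - (x + 1)\<close>.\<close>
        show "level k (Suc x) m s1"
          using s1 True by (auto simp: level_def popped_def of_nat_diff)
      next
        fix s2 assume "popped k m s1 s2"
        with s1 \<open>1 \<le> k\<close> have "popped k m s s2"
          by (auto simp: popped_def agree_def)
        from less.prems(7)[OF this]
        show "run outer_loop (\<lambda>i' j'. Q (3 + (i1 + (i2 + i'))) (1 + (j1 + (j2 + j')))) s2"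
          by (simp add: i j add.assoc)
      qed (use less.prems True in auto)
    qed (use less.prems True in auto)
    with less.prems(1,2) True show ?thesis by (rule run_push)
  next
    case False
    then have L: "num_dominant_ge x m = 1"
      using less.prems by (intro num_dominant_ge_eq_1) auto
    \<comment> \<open>The two missing tests are the successful outer test and the failing push
      test.\<close>
    have "run leaf (\<lambda>i' j' s'. i' = i \<and> j' + 2 = j \<and> popped k m s s') s"
      by (rule run_mono[OF run_leaf[OF less.prems(1-4)]]) (use False less.prems(5,6) L in auto)
    then have "run leaf (\<lambda>i' j'. run outer_loop (\<lambda>i'' j''. Q (i' + i'') (j' + 2 + j''))) s"
      by (rule run_mono) (use less.prems(7) in auto)
    then have "run (WHILE LessEq (Times (Num 3) (Var Vx)) (Var Vy) DO push_body ;; leaf)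
        (\<lambda>i' j'. run outer_loop (\<lambda>i'' j''. Q (i' + i'') (1 + j' + j''))) s"
      using less.prems(1) False by (subst run_Seq, subst run_While) (simp add: level_def)
    then show ?thesis
      using less.prems(1,2) unfolding outer_loop_def
      by (subst run_While) (simp add: level_def)
  qed
qed

theorem theorem6:
  fixes n :: nat and s :: state
  assumes "n \<ge> 1" and "fst s Vn = int n"
  shows "\<exists>s'. exec algorithm_B s (4 * p n + 5 * p3 n) (p n + 4 * p3 n) s'"
proof -
  have pos: "1 \<le> p3 n"
    using assms(1) by (simp add: p3_eq_num_dominant_ge num_dominant_ge_pos del: One_nat_def)
  let ?Q = "\<lambda>i j (s' :: state). i = 4 * p n + 5 * p3 n \<and> j = p n + 4 * p3 n"
  let ?s = "((fst s)(Vk := 1, Vx := 1, Vy := int n - 1), snd s)"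
  \<comment> \<open>The three initial assignments and the final failing outer test compensate the
    offsets 3 and 1.\<close>
  have "run outer_loop (\<lambda>i j. ?Q (3 + i) j) ?s"
  proof (rule run_outer_loop)
    show "level 1 1 n ?s" by (simp add: level_def)
    show "4 * p n + 5 * p3 n - 3 + 3 = 4 * num_ge 1 n + 5 * num_dominant_ge 1 n"
      "p n + 4 * p3 n - 1 + 1 = num_ge 1 n + 4 * num_dominant_ge 1 n"
      using pos by (simp_all add: p_eq_num_ge p3_eq_num_dominant_ge)
  next
    fix s1 assume "popped 1 n ?s s1"
    then show "run outer_loop (\<lambda>i' j'. ?Q (3 + (4 * p n + 5 * p3 n - 3 + i'))
        (p n + 4 * p3 n - 1 + j')) s1"
      using pos unfolding outer_loop_def by (subst run_While) (simp add: popped_def)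
  qed (use assms in auto)
  then have "run algorithm_B ?Q s"
    using assms(2) by (simp add: algorithm_B_outer_loop eval_nat_numeral)
  then show ?thesis by (auto simp: run_def)
qed

end
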